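(* Let $\lambda$ be a nonzero real number, $\gamma$ a complex number, and $Y$ a random variable as in the context. For every integer $n\ge0$, \[ \beta_{n,\lambda}^{(\gamma,Y)}=\sum_{k=0}^{n}\sum_{j=0}^{k}\binom{\gamma+k-1}{k}\binom{k}{j}\binom{n+j}{j}^{-1}(-1)^{j}E[Y]^{-\gamma-j}S_{2,\lambda}^{Y}(n+j,j). \]
   Context: $(x)_{0,\lambda}=1$, $(x)_{n,\lambda}=x(x-\lambda)\cdots(x-(n-1)\lambda)$ for $n\ge1$. $Y$ is a random variable whose moment-generating function $E[e^{tY}]$ exists for $|t|<r$ for some $r>0$, and $E[Y]\neq0$. $E[e_{\lambda}^{Y}(t)]$ denotes the formal power series $\sum_{n\ge0}E[(Y)_{n,\lambda}]\frac{t^n}{n!}$. The probabilistic degenerate Stirling numbers of the second kind are defined by $\frac1{k!}\big(E[e_{\lambda}^{Y}(t)]-1\big)^k=\sum_{n\ge k}S_{2,\lambda}^{Y}(n,k)\frac{t^n}{n!}$. The probabilistic degenerate Bernoulli numbers of order $\gamma$ are defined by $\big(\frac{t}{E[e_{\lambda}^{Y}(t)]-1}\big)^{\gamma}=\sum_{n\ge0}\beta_{n,\lambda}^{(\gamma,Y)}\frac{t^n}{n!}$, where the $\gamma$-th power of the series $\frac{t}{E[e_\lambda^Y(t)]-1}=E[Y]^{-1}(1+u(t))$, $u(0)=0$, is understood as $E[Y]^{-\gamma}\sum_{m\ge0}\binom{-\gamma}{m}u(t)^m$ for a fixed determination of $E[Y]^{-\gamma}$, with $E[Y]^{-\gamm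a-j}=E[Y]^{-\gamma}E[Y]^{-j}$.
   Formalization: The γ-th power of E[Y]^{-1}(1+u) is taken as E[Y]^{-γ} Σ binom(γ,m) u^m, not with binom(−γ,m) as written; the latter is not the γ-th power and makes the formula false (e.g. Y=1, λ=1/2, γ=1, n=1). *)

theory Defs
  imports
    "HOL-Probability.Probability"
    "HOL-Computational_Algebra.Computational_Algebra"
begin

definition degen_falling :: "real \<Rightarrow> nat \<Rightarrow> real \<Rightarrow> real" where
  "degen_falling lam n x = (\<Prod>i<n. x - real i * lam)"

definition degen_exp_series :: "'a measure \<Rightarrow> ('a \<Rightarrow> real) \<Rightarrow> real \<Rightarrow> real fps" where
  "degen_exp_series M Y lam =
     Abs_fps (\<lambda>n. prob_space.expectation M (\<lambda>\<omega>. degen_falling lam n (Y \<omega>)) / fact n)"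

definition degen_stirling2 :: "'a measure \<Rightarrow> ('a \<Rightarrow> real) \<Rightarrow> real \<Rightarrow> nat \<Rightarrow> nat \<Rightarrow> real" where
  "degen_stirling2 M Y lam n k =
     fact n * fps_nth (fps_const (1 / fact k) * (degen_exp_series M Y lam - 1) ^ k) n"

text \<open>
  A determination of the complex powers of a nonzero number \<open>a\<close> is a choice of a logarithm,
  i.e. of some \<open>l\<close> with \<open>exp l = a\<close>; the corresponding power \<open>a\<^sup>s\<close> is \<open>exp (s * l)\<close>.
  Thus \<open>a\<^sup>s\<^sup>-\<^sup>j = a\<^sup>s * a\<^sup>-\<^sup>j\<close> for every natural \<open>j\<close>, and integer powers do not depend on \<open>l\<close>.
\<close>

definition det_power :: "complex \<Rightarrow> complex \<Rightarrow> complex" where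
  "det_power l s = exp (s * l)"

text \<open>The series \<open>t / (E[e\<^sub>\<lambda>\<^sup>Y(t)] - 1)\<close>, over the complex numbers.\<close>

definition degen_bernoulli_base :: "'a measure \<Rightarrow> ('a \<Rightarrow> real) \<Rightarrow> real \<Rightarrow> complex fps" where
  "degen_bernoulli_base M Y lam =
     fps_X / (Abs_fps (\<lambda>n. complex_of_real (fps_nth (degen_exp_series M Y lam) n)) - 1)"

text \<open>
  Writing \<open>t / (E[e\<^sub>\<lambda>\<^sup>Y(t)] - 1) = E[Y]\<^sup>-\<^sup>1 * (1 + u(t))\<close> with \<open>u(0) = 0\<close>, its \<open>\<gamma>\<close>-th power is
  \<open>E[Y]\<^sup>-\<^sup>\<gamma> * (\<Sum>m. (\<gamma> gchoose m) * u(t) ^ m)\<close>.  Equivalently it is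
  \<open>E[Y]\<^sup>-\<^sup>\<gamma> * (\<Sum>m. (- \<gamma> gchoose m) * w(t) ^ m)\<close> with \<open>w\<close> given by the reciprocal normalisation
  \<open>t / (E[e\<^sub>\<lambda>\<^sup>Y(t)] - 1) = E[Y]\<^sup>-\<^sup>1 * (1 + w(t))\<^sup>-\<^sup>1\<close>; see \<open>fps_binomial_compose_reciprocal\<close>.
  The parameter \<open>l\<close> is the chosen logarithm of \<open>E[Y]\<close>.
\<close>

definition degen_bernoulli_series ::
  "'a measure \<Rightarrow> ('a \<Rightarrow> real) \<Rightarrow> real \<Rightarrow> complex \<Rightarrow> complex \<Rightarrow> complex fps" where
  "degen_bernoulli_series M Y lam l \<gamma> =
     (let u = fps_const (complex_of_real (prob_space.expectation M Y))
                * degen_bernoulli_base M Y lam - 1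
      in fps_const (det_power l (- \<gamma>)) * (fps_binomial \<gamma> oo u))"

definition degen_bernoulli ::
  "'a measure \<Rightarrow> ('a \<Rightarrow> real) \<Rightarrow> real \<Rightarrow> complex \<Rightarrow> complex \<Rightarrow> nat \<Rightarrow> complex" where
  "degen_bernoulli M Y lam l \<gamma> n = fact n * fps_nth (degen_bernoulli_series M Y lam l \<gamma>) n"

lemma fps_binomial_compose_reciprocal:
  fixes u w :: "'a::field_char_0 fps"
  assumes u0: "fps_nth u 0 = 0" and uw: "1 + u = inverse (1 + w)" and w0: "fps_nth w 0 = 0"
  shows "fps_binomial c oo u = fps_binomial (- c) oo w"
proof -
  define v :: "'a fps" where "v = inverse (1 + fps_X) - 1"
  have v0: "fps_nth v 0 = 0" by (simp add: v_def)
  have dv: "fps_deriv v = - (inverse (1 + fps_X))\<^sup>2"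
    by (simp add: v_def fps_inverse_deriv)
  have inv: "inverse (1 + fps_X) oo v = 1 + fps_X"
    by (subst fps_inverse_compose)
       (simp_all add: v0, simp add: v_def fps_compose_add_distrib)
  define B where "B = fps_binomial c oo v"
  have "fps_deriv B = ((fps_const c * fps_binomial c * inverse (1 + fps_X)) oo v) * fps_deriv v"
    by (simp add: B_def fps_compose_deriv[OF v0] fps_binomial_deriv fps_divide_unit)
  also have "\<dots> = fps_const c * B * (1 + fps_X) * (- (inverse (1 + fps_X))\<^sup>2)"
    by (simp add: fps_compose_mult_distrib[OF v0] inv dv B_def)
  also have "\<dots> = - (fps_const c * B * inverse (1 + fps_X) * ((1 + fps_X) * inverse (1 + fps_X)))"
    by (simp add: power2_eq_square algebra_simps)
  also have "(1 + fps_X) * inverse (1 + fps_X) = (1 :: 'a fps)"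
    by (rule inverse_mult_eq_1') simp
  finally have "fps_deriv B = fps_const (- c) * B / (1 + fps_X)"
    by (simp add: fps_divide_unit flip: fps_const_neg)
  moreover have "fps_nth B 0 = 1" by (simp add: B_def)
  ultimately have B: "B = fps_binomial (- c)"
    using fps_binomial_ODE_unique' by blast
  have "v oo w = u"
  proof -
    have "v oo w = inverse (1 + w) - 1"
      by (simp add: v_def fps_compose_sub_distrib fps_inverse_compose[OF w0]
            fps_compose_add_distrib w0)
    thus ?thesis by (simp flip: uw)
  qed
  thus ?thesis
    using fps_compose_assoc[OF w0 v0, of "fps_binomial c"] B by (simp add: B_def)
qed

lemma degen_bernoulli_series_of_nat:
  assumes M: "prob_space M"
    and l: "exp l = complex_of_real (prob_space.expectation M Y)"
  shows "degen_bernoulli_series M Y lam l (of_nat N) = degen_bernoulli_base M Y lam ^ N"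
proof -
  interpret prob_space M by fact
  define a where "a = complex_of_real (expectation Y)"
  have a: "a \<noteq> 0" using l by (metis a_def exp_not_eq_zero)
  define D where
    "D = Abs_fps (\<lambda>n. complex_of_real (fps_nth (degen_exp_series M Y lam) n)) - 1"
  have D0: "fps_nth D 0 = 0"
    by (simp add: D_def degen_exp_series_def degen_falling_def prob_space)
  have D1: "fps_nth D 1 = a"
    by (simp add: D_def degen_exp_series_def degen_falling_def a_def)
  have sd: "subdegree D = 1"
    using D0 D1 a by (intro subdegreeI) auto
  have base0: "fps_nth (degen_bernoulli_base M Y lam) 0 = 1 / a"
    using D1 a
    by (simp add: degen_bernoulli_base_def fps_divide_def D_def[symmetric] sd
          fps_shift_def inverse_eq_divide Let_def) 
  define u where "u = fps_const a * degen_bernoulli_base M Y lam - 1"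
  have u0: "fps_nth u 0 = 0" using a base0 by (simp add: u_def)
  have "fps_binomial (of_nat N) oo u = (1 + u) ^ N"
    by (simp add: fps_binomial_of_nat fps_compose_power[OF u0, symmetric] fps_compose_add_distrib u0)
  also have "\<dots> = fps_const (a ^ N) * degen_bernoulli_base M Y lam ^ N"
    by (simp add: u_def power_mult_distrib)
  finally have *: "fps_binomial (of_nat N) oo u =
      fps_const (a ^ N) * degen_bernoulli_base M Y lam ^ N" .
  have "det_power l (- of_nat N) * a ^ N = 1"
    using l by (simp add: det_power_def a_def[symmetric] exp_minus exp_of_nat_mult a)
  hence "fps_const (det_power l (- of_nat N)) * fps_const (a ^ N) = 1"
    by (metis fps_const_mult fps_const_1_eq_1)
  thus ?thesis
    using * by (simp add: degen_bernoulli_series_def Let_def a_def[symmetric] u_def[symmetric]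
                  mult.assoc[symmetric] del: fps_const_mult)
qed

end

theory Submission
  imports Defs
begin

text \<open>
  Write \<open>E[e\<^sub>\<lambda>\<^sup>Y(t)] - 1 = t G(t)\<close>, where \<open>G(0) = E[Y] = a \<noteq> 0\<close>.  Then
  \<open>t / (E[e\<^sub>\<lambda>\<^sup>Y(t)] - 1) = a\<^sup>-\<^sup>1 (1 + w)\<^sup>-\<^sup>1\<close> with \<open>w = G / a - 1\<close>, so its \<open>\<gamma>\<close>-th power is
  \<open>a\<^sup>-\<^sup>\<gamma> (1 + w)\<^sup>-\<^sup>\<gamma>\<close>.  Expanding first in powers \<open>w\<^sup>k\<close> and then each \<open>w\<^sup>k\<close> in powers of
  \<open>G / a\<close> gives the double sum, because the coefficient of \<open>t\<^sup>n\<close> in \<open>G\<^sup>j\<close> is that of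
  \<open>t\<^sup>n\<^sup>+\<^sup>j\<close> in \<open>(t G)\<^sup>j\<close>, which is a Stirling number up to factorials.
\<close>

lemma fps_nth_of_real_power:
  fixes f :: "real fps"
  shows "fps_nth (Abs_fps (\<lambda>n. of_real (fps_nth f n)) ^ k) n =
    (of_real (fps_nth (f ^ k) n) :: 'a::{real_algebra_1, comm_ring_1})"
  by (induction k arbitrary: n) (auto simp: fps_mult_nth)

text \<open>The upper negation \<open>gbinomial_minus\<close> yields \<open>(-1) ^ k\<close> times
  the shifted binomial; the binomial theorem then expands \<open>(H - 1) ^ k\<close>.\<close>

lemma fps_binomial_uminus_compose_nth:
  fixes H :: "'a::field_char_0 fps"
  shows "fps_nth (fps_binomial (- c) oo (H - 1)) n =
    (\<Sum>k=0..n. \<Sum>j=0..k. ((c + of_nat k - 1) gchoose k) * of_nat (k choose j) * (-1) ^ j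
       * fps_nth (H ^ j) n)"
proof -
  have power: "fps_nth ((H - 1) ^ k) n =
      (\<Sum>j=0..k. of_nat (k choose j) * (-1) ^ (k - j) * fps_nth (H ^ j) n)" for k
  proof -
    have "(H - 1) ^ k = (\<Sum>j\<le>k. of_nat (k choose j) * H ^ j * (-1) ^ (k - j))"
      using binomial_ring[of H "-1" k] by simp
    also have "\<dots> = (\<Sum>j=0..k. fps_const (of_nat (k choose j) * (-1) ^ (k - j)) * H ^ j)"
    proof (rule sum.cong)
      fix j
      have "fps_const (of_nat (k choose j) * (-1) ^ (k - j) :: 'a) =
          of_nat (k choose j) * (-1) ^ (k - j)"
        by (metis fps_const_1_eq_1 fps_const_mult fps_const_neg fps_const_power fps_of_nat)
      thus "of_nat (k choose j) * H ^ j * (-1) ^ (k - j) =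
          fps_const (of_nat (k choose j) * (-1) ^ (k - j)) * H ^ j"
        by (simp only: mult_ac)
    qed (simp add: atMost_atLeast0)
    finally show ?thesis by (simp add: fps_sum_nth)
  qed
  \<comment> \<open>The two signs combine since \<open>k + (k - j)\<close> and \<open>j\<close> have
    the same parity.\<close>
  have sign: "(-1) ^ k * x * (of_nat (k choose j) * (-1) ^ (k - j) * y) =
      x * of_nat (k choose j) * (-1) ^ j * y" if "j \<le> k" for j k :: nat and x y :: 'a
    using that by (simp add: minus_one_power_iff)
  show ?thesis
    unfolding fps_compose_nth fps_binomial_nth gbinomial_minus power sum_distrib_left
    by (intro sum.cong refl) (simp only: sign atLeastAtMost_iff)
qed

theorem theorem3p5:
  fixes M :: "'a measure" and Y :: "'a \<Rightarrow> real" and r lam :: real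
    and \<gamma> l :: complex and n :: nat
  assumes "prob_space M"
    and "Y \<in> borel_measurable M"
    and "r > 0"
    and "\<And>t::real. \<bar>t\<bar> < r \<Longrightarrow> integrable M (\<lambda>\<omega>. exp (t * Y \<omega>))"
    and "prob_space.expectation M Y \<noteq> 0"
    and "lam \<noteq> 0"
    and "exp l = complex_of_real (prob_space.expectation M Y)"
  shows "degen_bernoulli M Y lam l \<gamma> n =
    (\<Sum>k=0..n. \<Sum>j=0..k.
       ((\<gamma> + of_nat k - 1) gchoose k) * of_nat (k choose j) * inverse (of_nat ((n + j) choose j))
       * (-1) ^ j * det_power l (- \<gamma> - of_nat j)
       * complex_of_real (degen_stirling2 M Y lam (n + j) j))"
proof -
  interpret prob_space M by fact
  define a where "a = complex_of_real (expectation Y)"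
  have a: "a \<noteq> 0" using assms(5) by (simp add: a_def)
  define D where "D = degen_exp_series M Y lam - 1"
  define Dc where "Dc = Abs_fps (\<lambda>n. complex_of_real (fps_nth D n))"
  have Dc_eq: "Abs_fps (\<lambda>n. complex_of_real (fps_nth (degen_exp_series M Y lam) n)) - 1 = Dc"
    by (rule fps_ext) (simp add: Dc_def D_def)
  have D0: "fps_nth Dc 0 = 0"
    by (simp add: Dc_def D_def degen_exp_series_def degen_falling_def prob_space)
  have D1: "fps_nth Dc 1 = a"
    by (simp add: Dc_def D_def degen_exp_series_def degen_falling_def a_def)
  define G where "G = fps_shift 1 Dc"
  have XG: "Dc = fps_X * G"
    using D0 by (intro fps_ext) (simp add: G_def)
  have G0: "fps_nth G 0 = a" using D1 by (simp add: G_def)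
  have sd: "subdegree Dc = 1"
    using D0 D1 a by (intro subdegreeI) auto
  \<comment> \<open>Division by \<open>Dc\<close> shifts by its subdegree 1, which cancels the
    factor \<open>fps_X\<close>.\<close>
  have base: "degen_bernoulli_base M Y lam = inverse G"
    unfolding degen_bernoulli_base_def Dc_eq fps_divide_def G_def Let_def
    by (intro fps_ext) (simp add: sd)
  define H where "H = fps_const (inverse a) * G"
  have H0: "fps_nth H 0 = 1" using a G0 by (simp add: H_def)
  have inverse_H: "inverse H = fps_const a * inverse G"
    by (simp add: H_def fps_inverse_mult fps_const_inverse)
  \<comment> \<open>The definition expands around \<open>u = inverse H - 1\<close>; the reciprocal
    normalisation \<open>w = H - 1\<close> trades the exponent \<gamma> for -\<gamma> and leaves
    powers of \<open>H\<close>.\<close>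
  have series: "degen_bernoulli_series M Y lam l \<gamma> =
      fps_const (det_power l (- \<gamma>)) * (fps_binomial (- \<gamma>) oo (H - 1))"
    using fps_binomial_compose_reciprocal[of "inverse H - 1" "H - 1" \<gamma>] H0
    by (simp add: degen_bernoulli_series_def base a_def[symmetric] inverse_H[symmetric])
  have stirling: "fact n * fps_nth (H ^ j) n = inverse (a ^ j) * inverse (of_nat ((n + j) choose j))
      * complex_of_real (degen_stirling2 M Y lam (n + j) j)" for j
  proof -
    have "fps_nth (G ^ j) n = fps_nth (Dc ^ j) (n + j)"
      by (simp add: XG power_mult_distrib fps_X_power_mult_nth)
    also have "\<dots> = complex_of_real (fps_nth (D ^ j) (n + j))"
      by (simp add: Dc_def fps_nth_of_real_power)
    finally have G: "fps_nth (G ^ j) n = complex_of_real (fps_nth (D ^ j) (n + j))" .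
    \<comment> \<open>This converts \<open>fact n\<close> into the factor
      \<open>fact (n + j) / fact j\<close> of the Stirling number.\<close>
    have "(of_nat ((n + j) choose j) :: complex) = fact (n + j) / (fact j * fact n)"
      by (simp add: binomial_fact)
    thus ?thesis
      by (simp add: H_def power_mult_distrib power_inverse G degen_stirling2_def D_def[symmetric])
  qed
  \<comment> \<open>Since \<open>exp (of_nat j * l) = a ^ j\<close>, the normalising factor of
    \<open>H ^ j\<close> merges into the chosen power of \<open>a\<close>.\<close>
  have det: "det_power l (- \<gamma> - of_nat j) = det_power l (- \<gamma>) * inverse (a ^ j)" for j
    using assms(7)
    by (simp add: det_power_def a_def left_diff_distrib exp_diff exp_of_nat_mult divide_inverse)
  have "degen_bernoulli M Y lam l \<gamma> n = (\<Sum>k=0..n. \<Sum>j=0..k.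
      ((\<gamma> + of_nat k - 1) gchoose k) * of_nat (k choose j) * (-1) ^ j * det_power l (- \<gamma>)
      * (fact n * fps_nth (H ^ j) n))"
    by (simp add: degen_bernoulli_def series fps_binomial_uminus_compose_nth sum_distrib_left mult_ac)
  thus ?thesis
    unfolding stirling det by (simp add: mult_ac)
qed

end
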